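(* Let $L=L(a,b)$ be the free Lie ring (Lie algebra over $\mathbb{Z}$) on two letters $a,b$, and let $I_{3,6}$ be the kernel of the map $\Theta_{3,6}:L_{2,6}\oplus L_{3,5}\to L_{3,6}$, $\Theta_{3,6}(A,B)=[A,a]+[B,b]$. Then the abelian group $I_{3,6}$ is generated by the element $$\bigl(-2[C_5,C_1]-5[C_4,C_2]\,,\ 2[C_4,C_1,C_0]+3[C_3,C_2,C_0]-2[C_3,C_1,C_1]+[C_2,C_1,C_2]\bigr).$$
   Context: $L_{k,m}\subseteq L$ denotes the abelian subgroup generated by all iterated commutators in which $a$ occurs exactly $k$ times and $b$ occurs exactly $m$ times. For $n\ge0$, $C_n=[a,_n b]$, i.e. $C_0=a$ and $C_{n+1}=[C_n,b]$. Brackets with more than two entries are left-normed: $[x,y,z]=[[x,y],z]$. *)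

theory Defs
  imports Main "HOL.Hull" "HOL-Library.Product_Plus"
begin

section \<open>Lie rings\<close>

class lie_ring = ab_group_add +
  fixes lie :: "'a \<Rightarrow> 'a \<Rightarrow> 'a"  ("\<lbrace>_, _\<rbrace>")
  assumes lie_add_left: "\<lbrace>x + y, z\<rbrace> = \<lbrace>x, z\<rbrace> + \<lbrace>y, z\<rbrace>"
    and lie_add_right: "\<lbrace>x, y + z\<rbrace> = \<lbrace>x, y\<rbrace> + \<lbrace>x, z\<rbrace>"
    and lie_self: "\<lbrace>x, x\<rbrace> = 0"
    and lie_jacobi: "\<lbrace>\<lbrace>x, y\<rbrace>, z\<rbrace> + \<lbrace>\<lbrace>y, z\<rbrace>, x\<rbrace> + \<lbrace>\<lbrace>z, x\<rbrace>, y\<rbrace> = 0"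

context ab_group_add
begin

definition zmult :: "int \<Rightarrow> 'a \<Rightarrow> 'a"  (infixr "*\<^sub>Z" 75) where
  "n *\<^sub>Z x = (if 0 \<le> n then ((+) x ^^ nat n) 0 else - (((+) x ^^ nat (- n)) 0))"

definition add_subgroup :: "'a set \<Rightarrow> bool" where
  "add_subgroup H \<longleftrightarrow> 0 \<in> H \<and> (\<forall>x\<in>H. \<forall>y\<in>H. x + y \<in> H) \<and> (\<forall>x\<in>H. - x \<in> H)"

text \<open>The subgroup generated by \<open>S\<close> is \<^term>\<open>add_subgroup hull S\<close>.\<close>

end

section \<open>The free Lie ring on a set of letters\<close>

text \<open>
  The free Lie ring on \<^typ>\<open>'x\<close> is the term algebra in the Lie ring operations modulo the least
  congruence that contains all instances of the Lie ring axioms.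
\<close>

datatype 'x lie_term =
    Gen 'x
  | Zero
  | Add "'x lie_term" "'x lie_term"
  | Neg "'x lie_term"
  | Br "'x lie_term" "'x lie_term"

inductive lie_eq :: "'x lie_term \<Rightarrow> 'x lie_term \<Rightarrow> bool" where
  refl: "lie_eq s s"
| sym: "lie_eq s t \<Longrightarrow> lie_eq t s"
| trans: "lie_eq s t \<Longrightarrow> lie_eq t u \<Longrightarrow> lie_eq s u"
| cong_Add: "lie_eq s s' \<Longrightarrow> lie_eq t t' \<Longrightarrow> lie_eq (Add s t) (Add s' t')"
| cong_Neg: "lie_eq s s' \<Longrightarrow> lie_eq (Neg s) (Neg s')"
| cong_Br: "lie_eq s s' \<Longrightarrow> lie_eq t t' \<Longrightarrow> lie_eq (Br s t) (Br s' t')"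
| Add_assoc: "lie_eq (Add (Add s t) u) (Add s (Add t u))"
| Add_commute: "lie_eq (Add s t) (Add t s)"
| Add_Zero: "lie_eq (Add Zero s) s"
| Add_Neg: "lie_eq (Add (Neg s) s) Zero"
| Br_Add_left: "lie_eq (Br (Add s t) u) (Add (Br s u) (Br t u))"
| Br_Add_right: "lie_eq (Br s (Add t u)) (Add (Br s t) (Br s u))"
| Br_self: "lie_eq (Br s s) Zero"
| Br_jacobi: "lie_eq (Add (Add (Br (Br s t) u) (Br (Br t u) s)) (Br (Br u s) t)) Zero"

quotient_type 'x free_lie = "'x lie_term" / lie_eq
  by (rule equivpI)
    (auto intro!: reflpI sympI transpI intro: lie_eq.refl lie_eq.sym lie_eq.trans)

lift_definition gen :: "'x \<Rightarrow> 'x free_lie" is Gen .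

instantiation free_lie :: (type) lie_ring
begin

lift_definition zero_free_lie :: "'a free_lie" is Zero .

lift_definition plus_free_lie :: "'a free_lie \<Rightarrow> 'a free_lie \<Rightarrow> 'a free_lie" is Add
  by (rule lie_eq.cong_Add)

lift_definition uminus_free_lie :: "'a free_lie \<Rightarrow> 'a free_lie" is Neg
  by (rule lie_eq.cong_Neg)

lift_definition lie_free_lie :: "'a free_lie \<Rightarrow> 'a free_lie \<Rightarrow> 'a free_lie" is Br
  by (rule lie_eq.cong_Br)

definition minus_free_lie :: "'a free_lie \<Rightarrow> 'a free_lie \<Rightarrow> 'a free_lie" where
  "minus_free_lie x y = x + - y"

instance
proof
  fix x y z :: "'a free_lie"
  show "x + y + z = x + (y + z)" by transfer (rule lie_eq.Add_assoc)
  show "x + y = y + x" by transfer (rule lie_eq.Add_commute)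
  show "0 + x = x" by transfer (rule lie_eq.Add_Zero)
  show "- x + x = 0" by transfer (rule lie_eq.Add_Neg)
  show "x - y = x + - y" by (rule minus_free_lie_def)
  show "\<lbrace>x + y, z\<rbrace> = \<lbrace>x, z\<rbrace> + \<lbrace>y, z\<rbrace>" by transfer (rule lie_eq.Br_Add_left)
  show "\<lbrace>x, y + z\<rbrace> = \<lbrace>x, y\<rbrace> + \<lbrace>x, z\<rbrace>" by transfer (rule lie_eq.Br_Add_right)
  show "\<lbrace>x, x\<rbrace> = 0" by transfer (rule lie_eq.Br_self)
  show "\<lbrace>\<lbrace>x, y\<rbrace>, z\<rbrace> + \<lbrace>\<lbrace>y, z\<rbrace>, x\<rbrace> + \<lbrace>\<lbrace>z, x\<rbrace>, y\<rbrace> = 0"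
    by transfer (rule lie_eq.Br_jacobi)
qed

end

subsection \<open>Universal property\<close>

primrec lie_term_eval :: "('x \<Rightarrow> 'l::lie_ring) \<Rightarrow> 'x lie_term \<Rightarrow> 'l" where
  "lie_term_eval f (Gen x) = f x"
| "lie_term_eval f Zero = 0"
| "lie_term_eval f (Add s t) = lie_term_eval f s + lie_term_eval f t"
| "lie_term_eval f (Neg s) = - lie_term_eval f s"
| "lie_term_eval f (Br s t) = \<lbrace>lie_term_eval f s, lie_term_eval f t\<rbrace>"

lemma lie_term_eval_cong: "lie_eq s t \<Longrightarrow> lie_term_eval f s = lie_term_eval f t"
  by (induction rule: lie_eq.induct)
    (simp_all add: add.assoc add.commute lie_add_left lie_add_right lie_self
      lie_jacobi[unfolded add.assoc])

lift_definition free_lie_lift :: "('x \<Rightarrow> 'l::lie_ring) \<Rightarrow> 'x free_lie \<Rightarrow> 'l" is lie_term_eval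
  by (rule lie_term_eval_cong)

theorem free_lie_universal:
  fixes f :: "'x \<Rightarrow> 'l::lie_ring"
  shows "\<exists>!h :: 'x free_lie \<Rightarrow> 'l.
    (\<forall>u v. h (u + v) = h u + h v) \<and> (\<forall>u v. h \<lbrace>u, v\<rbrace> = \<lbrace>h u, h v\<rbrace>) \<and> (\<forall>x. h (gen x) = f x)"
proof (rule ex1I[of _ "free_lie_lift f"])
  show "(\<forall>u v. free_lie_lift f (u + v) = free_lie_lift f u + free_lie_lift f v) \<and>
    (\<forall>u v. free_lie_lift f \<lbrace>u, v\<rbrace> = \<lbrace>free_lie_lift f u, free_lie_lift f v\<rbrace>) \<and>
    (\<forall>x. free_lie_lift f (gen x) = f x)"
    by (intro conjI allI; transfer; simp)
next
  fix h :: "'x free_lie \<Rightarrow> 'l"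
  assume h: "(\<forall>u v. h (u + v) = h u + h v) \<and> (\<forall>u v. h \<lbrace>u, v\<rbrace> = \<lbrace>h u, h v\<rbrace>) \<and>
    (\<forall>x. h (gen x) = f x)"
  have h0: "h 0 = 0"
    using h by (metis add_cancel_right_right)
  have hneg: "h (- u) = - h u" for u
    using h h0 by (metis add.left_inverse add_eq_0_iff2)
  have "h (abs_free_lie t) = lie_term_eval f t" for t
  proof (induction t)
    case (Gen x)
    then show ?case using h by (metis gen.abs_eq lie_term_eval.simps(1))
  next
    case Zero
    then show ?case using h0 by (simp add: zero_free_lie.abs_eq)
  next
    case (Add s t)
    then show ?case using h by (metis plus_free_lie.abs_eq lie_term_eval.simps(3))
  next
    case (Neg s)
    then show ?case using hneg by (metis uminus_free_lie.abs_eq lie_term_eval.simps(4))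
  next
    case (Br s t)
    then show ?case using h by (metis lie_free_lie.abs_eq lie_term_eval.simps(5))
  qed
  then have "h u = free_lie_lift f u" for u
    by (induction u rule: free_lie.abs_induct) (simp add: free_lie_lift.abs_eq)
  then show "h = free_lie_lift f" ..
qed

section \<open>Two letters\<close>

datatype letter = Letter_a | Letter_b

abbreviation gen_a :: "letter free_lie"  ("\<a>") where "\<a> \<equiv> gen Letter_a"
abbreviation gen_b :: "letter free_lie"  ("\<b>") where "\<b> \<equiv> gen Letter_b"

text \<open>
  \<open>iterated_commutator k m w\<close>: \<open>w\<close> is the value of some (arbitrarily bracketed) commutator in
  the letters with exactly \<open>k\<close> occurrences of \<open>a\<close> and \<open>m\<close> occurrences of \<open>b\<close>; single letters count
  as commutators of length one.
\<close>

inductive iterated_commutator :: "nat \<Rightarrow> nat \<Rightarrow> letter free_lie \<Rightarrow> bool" where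
  letter_a: "iterated_commutator 1 0 \<a>"
| letter_b: "iterated_commutator 0 1 \<b>"
| bracket: "iterated_commutator k m u \<Longrightarrow> iterated_commutator k' m' v \<Longrightarrow>
    iterated_commutator (k + k') (m + m') \<lbrace>u, v\<rbrace>"

definition L :: "nat \<Rightarrow> nat \<Rightarrow> letter free_lie set" where
  "L k m = add_subgroup hull {w. iterated_commutator k m w}"

primrec C :: "nat \<Rightarrow> letter free_lie" where
  "C 0 = \<a>"
| "C (Suc n) = \<lbrace>C n, \<b>\<rbrace>"

fun Theta :: "letter free_lie \<times> letter free_lie \<Rightarrow> letter free_lie" where
  "Theta (A, B) = \<lbrace>A, \<a>\<rbrace> + \<lbrace>B, \<b>\<rbrace>"

text \<open>
  The kernel of \<^const>\<open>Theta\<close> as a map from \<open>L (k - 1) m \<times> L k (m - 1)\<close> to \<open>L k m\<close>, inside the product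
  group. As subtraction is truncated, this is meant for positive \<open>k\<close> and \<open>m\<close> only.
\<close>

definition I :: "nat \<Rightarrow> nat \<Rightarrow> (letter free_lie \<times> letter free_lie) set" where
  "I k m = {p \<in> L (k - 1) m \<times> L k (m - 1). Theta p = 0}"

lemma add_subgroup_hull: "add_subgroup (add_subgroup hull S)"
  unfolding hull_def by (auto simp: add_subgroup_def)

lemma L_bracket_letter:
  assumes g: "iterated_commutator k' m' g" and A: "A \<in> L k m"
  shows "\<lbrace>A, g\<rbrace> \<in> L (k + k') (m + m')"
proof -
  have sub: "add_subgroup (L (k + k') (m + m'))"
    unfolding L_def by (rule add_subgroup_hull)
  have zero: "\<lbrace>0, g\<rbrace> = 0"
    using lie_add_left[of 0 0 g] by simp
  have neg: "\<lbrace>- x, g\<rbrace> = - \<lbrace>x, g\<rbrace>" for x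
    using lie_add_left[of "- x" x g] zero by (simp add: eq_neg_iff_add_eq_0)
  let ?H = "{x. \<lbrace>x, g\<rbrace> \<in> L (k + k') (m + m')}"
  have "add_subgroup ?H"
    using sub by (auto simp: add_subgroup_def lie_add_left zero neg)
  moreover have "{w. iterated_commutator k m w} \<subseteq> ?H"
    using iterated_commutator.bracket[OF _ g] by (auto simp: L_def intro!: hull_inc)
  ultimately have "L k m \<subseteq> ?H"
    unfolding L_def by (intro hull_minimal)
  with A show ?thesis by auto
qed

lemma Theta_in_L:
  assumes "A \<in> L k (Suc m)" "B \<in> L (Suc k) m"
  shows "Theta (A, B) \<in> L (Suc k) (Suc m)"
proof -
  have "\<lbrace>A, \<a>\<rbrace> \<in> L (Suc k) (Suc m)"
    using L_bracket_letter[OF iterated_commutator.letter_a assms(1)] by simp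
  moreover have "\<lbrace>B, \<b>\<rbrace> \<in> L (Suc k) (Suc m)"
    using L_bracket_letter[OF iterated_commutator.letter_b assms(2)] by simp
  ultimately show ?thesis
    using add_subgroup_hull[of "{w. iterated_commutator (Suc k) (Suc m) w}"]
    by (simp add: L_def add_subgroup_def)
qed

end

theory Submission
  imports Defs "HOL-Library.Function_Algebras"
begin

text \<open>
  Every element of \<open>L 2 m\<close> and \<open>L 3 m\<close> is an integer combination of the commutators \<open>[C i, C j]\<close> with
  \<open>i > j\<close>, respectively \<open>[C i, C j, C k]\<close> with \<open>i > j\<close> and \<open>i \<ge> k\<close>. To compare coefficients, the
  free Lie ring is represented on the functions on words over \<open>\<nat>\<close>: \<open>C n\<close> acts by the shift
  \<open>f \<mapsto> (w \<mapsto> f (n # w))\<close>, and \<open>b\<close> by the dual of the derivation that increases each entry in turn.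
  An element of the kernel thus yields a system of linear equations in its ten coefficients,
  whose integer solutions are the multiples of the given one. That the given pair lies in the
  kernel is a single instance of the Jacobi identity, for \<open>C 3\<close>, \<open>C 2\<close>, \<open>C 1\<close>.
\<close>

section \<open>Integer multiples and generated subgroups\<close>

lemma zmult_0 [simp]: "0 *\<^sub>Z (x::'a::ab_group_add) = 0"
  by (simp add: zmult_def)

text \<open>\<open>zmult\<close> is defined by the sign of its factor; this is the one law proved by
  cases on that sign. The later ones rest on this recurrence.\<close>

lemma zmult_Suc: "(n + 1) *\<^sub>Z (x::'a::ab_group_add) = n *\<^sub>Z x + x"
proof (cases "0 \<le> n")
  case True
  then have "nat (n + 1) = Suc (nat n)" by simp
  with True show ?thesis by (simp add: zmult_def add.commute)
next
  case False
  then have "nat (- n) = Suc (nat (- (n + 1)))" by simp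
  with False show ?thesis by (auto simp: zmult_def)
qed

lemma zmult_1 [simp]: "1 *\<^sub>Z (x::'a::ab_group_add) = x"
  using zmult_Suc[of 0 x] by simp

text \<open>The recurrence determines \<open>F\<close> upwards and downwards from its value at 0, so
  identities about multiples need no distinction of signs.\<close>

lemma zmult_eqI:
  fixes x :: "'a::ab_group_add"
  assumes "F 0 = 0" and Suc: "\<And>n. F (n + 1) = F n + x"
  shows "F n = n *\<^sub>Z x"
proof (induction n rule: int_induct[of _ 0])
  case (step2 i)
  then show ?case using Suc[of "i - 1"] zmult_Suc[of "i - 1" x] by simp
qed (simp_all add: assms zmult_Suc)

lemma zmult_add_left: "(m + n) *\<^sub>Z (x::'a::ab_group_add) = m *\<^sub>Z x + n *\<^sub>Z x"
proof -
  have "(m + 1 + n) *\<^sub>Z x = (m + n) *\<^sub>Z x + x" for m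
    using zmult_Suc[of "m + n" x] by (simp add: add_ac)
  then have "(m + n) *\<^sub>Z x - n *\<^sub>Z x = m *\<^sub>Z x"
    \<comment> \<open>Subtracting the multiple by \<open>n\<close> makes this function of
      \<open>m\<close> start at 0.\<close>
    by (intro zmult_eqI[of "\<lambda>m. (m + n) *\<^sub>Z x - n *\<^sub>Z x"]) simp_all
  then show ?thesis by (simp add: diff_eq_eq)
qed

lemma zmult_minus_left: "(- n) *\<^sub>Z (x::'a::ab_group_add) = - (n *\<^sub>Z x)"
  using zmult_add_left[of "- n" n x] by (simp add: eq_neg_iff_add_eq_0)

lemma additive_0:
  fixes h :: "'a::ab_group_add \<Rightarrow> 'b::ab_group_add"
  assumes "\<And>x y. h (x + y) = h x + h y"
  shows "h 0 = 0"
  using assms[of 0 0] by simp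

lemma additive_minus:
  fixes h :: "'a::ab_group_add \<Rightarrow> 'b::ab_group_add"
  assumes "\<And>x y. h (x + y) = h x + h y"
  shows "h (- x) = - h x"
  using assms[of "- x" x] additive_0[OF assms] by (simp add: eq_neg_iff_add_eq_0)

lemma additive_diff:
  fixes h :: "'a::ab_group_add \<Rightarrow> 'b::ab_group_add"
  assumes "\<And>x y. h (x + y) = h x + h y"
  shows "h (x - y) = h x - h y"
  using assms[of x "- y"] additive_minus[OF assms] by simp

lemma additive_zmult:
  fixes h :: "'a::ab_group_add \<Rightarrow> 'b::ab_group_add"
  assumes "\<And>x y. h (x + y) = h x + h y"
  shows "h (n *\<^sub>Z x) = n *\<^sub>Z h x"
  by (rule zmult_eqI[of "\<lambda>n. h (n *\<^sub>Z x)"]) (simp_all add: assms additive_0[of h] zmult_Suc)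

lemma zmult_add_right: "n *\<^sub>Z ((x::'a::ab_group_add) + y) = n *\<^sub>Z x + n *\<^sub>Z y"
  by (rule zmult_eqI[of "\<lambda>n. n *\<^sub>Z x + n *\<^sub>Z y", symmetric]) (simp_all add: zmult_Suc algebra_simps)

lemmas zmult_minus_right = additive_minus[of "zmult n" for n, OF zmult_add_right]
lemmas zmult_diff_right = additive_diff[of "zmult n" for n, OF zmult_add_right]

lemma zmult_int [simp]: "n *\<^sub>Z (x::int) = n * x"
  by (rule zmult_eqI[of "\<lambda>n. n * x", symmetric]) (simp_all add: algebra_simps)

lemma zmult_zmult: "m *\<^sub>Z n *\<^sub>Z (x::'a::ab_group_add) = (m * n) *\<^sub>Z x"
  using additive_zmult[of "\<lambda>k. k *\<^sub>Z x" m n] by (simp add: zmult_add_left)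

lemma zmult_Pair: "n *\<^sub>Z (x, y) = (n *\<^sub>Z x, n *\<^sub>Z y)"
  using additive_zmult[of fst n "(x, y)"] additive_zmult[of snd n "(x, y)"]
  by (simp add: prod_eq_iff)

lemma add_subgroup_zmult:
  assumes "add_subgroup H" "x \<in> H"
  shows "n *\<^sub>Z x \<in> H"
proof (induction n rule: int_induct[of _ 0])
  case base
  then show ?case using assms by (simp add: add_subgroup_def)
next
  case (step1 i)
  then show ?case using assms by (simp add: add_subgroup_def zmult_Suc)
next
  case (step2 i)
  have "(i - 1) *\<^sub>Z x = i *\<^sub>Z x + - x" using zmult_Suc[of "i - 1" x] by simp
  with step2 show ?case using assms by (simp only: add_subgroup_def)
qed

lemma add_subgroup_diff:
  "add_subgroup H \<Longrightarrow> x \<in> H \<Longrightarrow> y \<in> H \<Longrightarrow> x - y \<in> H"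
  unfolding add_subgroup_def diff_conv_add_uminus by blast

lemma hull_0: "0 \<in> add_subgroup hull S"
  and hull_add: "x \<in> add_subgroup hull S \<Longrightarrow> y \<in> add_subgroup hull S \<Longrightarrow> x + y \<in> add_subgroup hull S"
  and hull_uminus: "x \<in> add_subgroup hull S \<Longrightarrow> - x \<in> add_subgroup hull S"
  using add_subgroup_hull[of S] by (simp_all add: add_subgroup_def)

text \<open>The preimage of a subgroup under an additive map is a subgroup. This reduces claims
  about brackets to brackets of generators.\<close>

lemma additive_hull:
  assumes h: "\<And>x y. h (x + y) = h x + h y"
    and S: "\<And>x. x \<in> S \<Longrightarrow> h x \<in> add_subgroup hull T"
    and x: "x \<in> add_subgroup hull S"
  shows "h x \<in> add_subgroup hull T"
proof -
  have "add_subgroup hull S \<subseteq> {x. h x \<in> add_subgroup hull T}"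
    using S by (intro hull_minimal)
      (auto simp: add_subgroup_def h additive_0[of h, OF h] additive_minus[of h, OF h]
        hull_0 hull_add hull_uminus)
  with x show ?thesis by blast
qed

lemma hull_empty: "add_subgroup hull {} = {0}"
  using hull_minimal[of "{}" "{0}" add_subgroup] hull_0[of "{}"]
  by (auto simp: add_subgroup_def)

text \<open>Applied repeatedly to a finite set, this peels off one generator at a time and produces
  integer coefficients; \<open>hull_empty\<close> ends the process.\<close>

lemma hull_insertE:
  assumes "x \<in> add_subgroup hull (insert s S)"
  obtains n y where "y \<in> add_subgroup hull S" "x = n *\<^sub>Z s + y"
proof -
  define H where "H = {n *\<^sub>Z s + y |n y. y \<in> add_subgroup hull S}"
  have HI: "n *\<^sub>Z s + y \<in> H" if "y \<in> add_subgroup hull S" for n y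
    unfolding H_def using that by blast
  have HE: "\<exists>n y. u = n *\<^sub>Z s + y \<and> y \<in> add_subgroup hull S" if "u \<in> H" for u
    using that unfolding H_def by blast
  have zero: "0 \<in> H" using HI[OF hull_0, of 0] by simp
  have plus: "u + v \<in> H" if u: "u \<in> H" and v: "v \<in> H" for u v
  proof -
    from u obtain m u' where u: "u = m *\<^sub>Z s + u'" "u' \<in> add_subgroup hull S" using HE by blast
    from v obtain n v' where v: "v = n *\<^sub>Z s + v'" "v' \<in> add_subgroup hull S" using HE by blast
    have "u + v = (m + n) *\<^sub>Z s + (u' + v')"
      unfolding u v by (simp add: zmult_add_left algebra_simps)
    then show ?thesis using HI[OF hull_add[OF u(2) v(2)]] by simp
  qed
  have minus: "- u \<in> H" if "u \<in> H" for u
  proof -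
    from that obtain m u' where u: "u = m *\<^sub>Z s + u'" "u' \<in> add_subgroup hull S" using HE by blast
    have "- u = (- m) *\<^sub>Z s + - u'"
      unfolding u by (simp add: zmult_minus_left)
    then show ?thesis using HI[OF hull_uminus[OF u(2)]] by simp
  qed
  have "add_subgroup H"
    unfolding add_subgroup_def using zero plus minus by blast
  moreover have "insert s S \<subseteq> H"
  proof
    fix u assume "u \<in> insert s S"
    then show "u \<in> H"
      using HI[OF hull_0, of 1] HI[OF hull_inc, of u 0] by auto
  qed
  ultimately have "add_subgroup hull (insert s S) \<subseteq> H" by (intro hull_minimal)
  with assms HE that show thesis by blast
qed

section \<open>Generators of the components\<close>

lemma lie_0_left [simp]: "\<lbrace>0, z\<rbrace> = (0::'a::lie_ring)"
  by (rule additive_0) (rule lie_add_left)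

lemmas lie_minus_left = additive_minus[of "\<lambda>x. \<lbrace>x, z\<rbrace>" for z :: "'a::lie_ring", OF lie_add_left]
lemmas lie_diff_left = additive_diff[of "\<lambda>x. \<lbrace>x, z\<rbrace>" for z :: "'a::lie_ring", OF lie_add_left]

text \<open>Polarization of \<open>lie_self\<close> at \<open>x + y\<close>.\<close>

lemma lie_swap: "\<lbrace>x, y\<rbrace> = - \<lbrace>y, x :: 'a::lie_ring\<rbrace>"
proof -
  have "\<lbrace>x + y, x + y\<rbrace> = \<lbrace>x, y\<rbrace> + \<lbrace>y, x\<rbrace>"
    unfolding lie_add_left lie_add_right by (simp add: lie_self)
  then show ?thesis by (simp only: lie_self eq_neg_iff_add_eq_0)
qed

text \<open>The Jacobi identity in the form that bracketing with \<open>z\<close> is a derivation.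
  For \<open>z\<close> = \<open>\<b>\<close> it raises the indices of the \<open>C n\<close> one at
  a time.\<close>

lemma lie_derivation: "\<lbrace>\<lbrace>x, y\<rbrace>, z\<rbrace> = \<lbrace>\<lbrace>x, z\<rbrace>, y\<rbrace> + \<lbrace>x, \<lbrace>y, z :: 'a::lie_ring\<rbrace>\<rbrace>"
  using lie_jacobi[of x y z] lie_swap[of "\<lbrace>y, z\<rbrace>" x] lie_swap[of z x]
  by (simp add: lie_minus_left algebra_simps)

lemma C_derivation: "\<lbrace>\<lbrace>C i, C j\<rbrace>, \<b>\<rbrace> = \<lbrace>C (Suc i), C j\<rbrace> + \<lbrace>C i, C (Suc j)\<rbrace>"
  using lie_derivation[of "C i" "C j" \<b>] by simp

lemma C_derivation3:
  "\<lbrace>\<lbrace>\<lbrace>C i, C j\<rbrace>, C k\<rbrace>, \<b>\<rbrace> = \<lbrace>\<lbrace>C (Suc i), C j\<rbrace>, C k\<rbrace> + \<lbrace>\<lbrace>C i, C (Suc j)\<rbrace>, C k\<rbrace>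
    + \<lbrace>\<lbrace>C i, C j\<rbrace>, C (Suc k)\<rbrace>"
  using lie_derivation[of "\<lbrace>C i, C j\<rbrace>" "C k" \<b>] by (simp only: C_derivation lie_add_left C.simps)

lemma iterated_commutator_C: "iterated_commutator (Suc 0) n (C n)"
proof (induction n)
  case 0
  then show ?case using letter_a by simp
next
  case (Suc n)
  then show ?case using bracket[OF _ letter_b, of "Suc 0" n] by simp
qed

text \<open>These sets turn out to generate a group containing \<open>L k m\<close> for
  \<open>k\<close> at most 3; the last branch is meant for \<open>k = 3\<close> only. In degree 0 in
  \<open>\<a>\<close> only \<open>\<b>\<close> itself remains, because the bracket of
  \<open>\<b>\<close> with itself vanishes.\<close>

definition commutators :: "nat \<Rightarrow> nat \<Rightarrow> letter free_lie set" where
  "commutators k m =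
    (if k = 0 then {w. m = 1 \<and> w = \<b>}
     else if k = 1 then {C m}
     else if k = 2 then {\<lbrace>C i, C j\<rbrace> |i j. i + j = m}
     else {\<lbrace>\<lbrace>C i, C j\<rbrace>, C l\<rbrace> |i j l. i + j + l = m})"

lemma commutators_2: "commutators 2 m = {\<lbrace>C i, C j\<rbrace> |i j. i + j = m}"
  by (simp add: commutators_def)

lemma commutators_3: "commutators 3 m = {\<lbrace>\<lbrace>C i, C j\<rbrace>, C l\<rbrace> |i j l. i + j + l = m}"
  by (simp add: commutators_def)

lemma lie_commutators_b:
  assumes "x \<in> commutators k m" "k \<le> 3"
  shows "\<lbrace>x, \<b>\<rbrace> \<in> add_subgroup hull commutators k (Suc m)"
proof -
  consider "k = 0" | "k = 1" | "k = 2" | "k = 3" using assms(2) by linarith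
  then show ?thesis
  proof cases
    case 1
    then show ?thesis using assms by (simp add: commutators_def lie_self hull_0)
  next
    case 2
    then show ?thesis using assms by (auto simp: commutators_def intro: hull_inc)
  next
    case 3
    then obtain i j where x: "x = \<lbrace>C i, C j\<rbrace>" "i + j = m"
      using assms by (auto simp: commutators_2)
    have "\<lbrace>C i, C j\<rbrace> \<in> commutators k (Suc m)" if "i + j = Suc m" for i j
      unfolding 3 commutators_2 using that by blast
    then show ?thesis
      unfolding x C_derivation using x(2) by (intro hull_add hull_inc) (simp_all del: C.simps)
  next
    case 4
    then obtain i j l where x: "x = \<lbrace>\<lbrace>C i, C j\<rbrace>, C l\<rbrace>" "i + j + l = m"
      using assms by (auto simp: commutators_3)
    have "\<lbrace>\<lbrace>C i, C j\<rbrace>, C l\<rbrace> \<in> commutators k (Suc m)" if "i + j + l = Suc m" for i j l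
      unfolding 4 commutators_3 using that by blast
    then show ?thesis
      unfolding x C_derivation3 using x(2) by (intro hull_add hull_inc) (simp_all del: C.simps)
  qed
qed

lemma iterated_commutator_in_hull:
  assumes "iterated_commutator k m w" "k \<le> 3"
  shows "w \<in> add_subgroup hull commutators k m"
  using assms
proof (induction rule: iterated_commutator.induct)
  case letter_a
  then show ?case by (simp add: commutators_def hull_inc)
next
  case letter_b
  then show ?case by (simp add: commutators_def hull_inc)
next
  case (bracket k m u k' m' v)
  let ?H = "add_subgroup hull commutators (k + k') (m + m')"
  have *: "\<lbrace>x, y\<rbrace> \<in> ?H" if x: "x \<in> commutators k m" and y: "y \<in> commutators k' m'" for x y
  proof -
    have swap: "\<lbrace>x, y\<rbrace> \<in> ?H" if "\<lbrace>y, x\<rbrace> \<in> ?H"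
      using hull_uminus[OF that] lie_swap[of x y] by simp
    \<comment> \<open>Total degree at most 3 in \<open>\<a>\<close> leaves few cases: a factor of
      degree 0 is \<open>\<b>\<close> and acts as a derivation; otherwise the degrees are 1 and 1,
      or 1 and 2 in some order, and the bracket is left-normed up to a swap.\<close>
    consider "k = 0" | "k' = 0" | "k = 1" "k' = 1" | "k = 1" "k' = 2" | "k = 2" "k' = 1"
      using bracket.prems by linarith
    then show ?thesis
    proof cases
      case 1
      then have "x = \<b>" "m = 1" using x by (auto simp: commutators_def)
      with 1 show ?thesis using lie_commutators_b[OF y] swap bracket.prems by simp
    next
      case 2
      then have "y = \<b>" "m' = 1" using y by (auto simp: commutators_def)
      with 2 show ?thesis using lie_commutators_b[OF x] bracket.prems by simp
    next
      case 3
      then show ?thesis using x y by (auto simp: commutators_def intro!: hull_inc)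
    next
      case 4
      then have "\<lbrace>y, x\<rbrace> \<in> commutators (k + k') (m + m')"
        using x y by (force simp: commutators_def)
      then show ?thesis by (intro swap hull_inc)
    next
      case 5
      then have "\<lbrace>x, y\<rbrace> \<in> commutators (k + k') (m + m')"
        using x y by (force simp: commutators_def)
      then show ?thesis by (rule hull_inc)
    qed
  qed
  have u: "u \<in> add_subgroup hull commutators k m"
    and v: "v \<in> add_subgroup hull commutators k' m'"
    using bracket by simp_all
  \<comment> \<open>Bilinearity extends the claim from generators to the subgroups, one argument at
    a time.\<close>
  have "\<lbrace>u, y\<rbrace> \<in> ?H" if "y \<in> commutators k' m'" for y
    by (rule additive_hull[where h = "\<lambda>x. \<lbrace>x, y\<rbrace>", OF lie_add_left *[OF _ that] u])
  then show ?case
    by (rule additive_hull[where h = "\<lambda>y. \<lbrace>u, y\<rbrace>", OF lie_add_right _ v])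
qed

lemma L_subset_hull: "k \<le> 3 \<Longrightarrow> L k m \<subseteq> add_subgroup hull commutators k m"
  unfolding L_def
  by (intro hull_minimal add_subgroup_hull) (auto intro: iterated_commutator_in_hull)

section \<open>Ordered commutators of degree two and three in \<open>\<a>\<close>\<close>

lemma L_2_subset: "L 2 m \<subseteq> add_subgroup hull {\<lbrace>C i, C j\<rbrace> |i j. j < i \<and> i + j = m}"
  (is "_ \<subseteq> ?H")
proof -
  have base: "\<lbrace>C i, C j\<rbrace> \<in> ?H" if "j < i" "i + j = m" for i j
    using that by (intro hull_inc) blast
  have "\<lbrace>C i, C j\<rbrace> \<in> ?H" if "i + j = m" for i j
  proof (cases i j rule: linorder_cases)
    case less
    then have "- \<lbrace>C j, C i\<rbrace> \<in> ?H" using that by (intro hull_uminus base) auto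
    then show ?thesis by (simp only: lie_swap[of "C i" "C j"])
  next
    case equal
    then show ?thesis by (simp add: lie_self hull_0)
  next
    case greater
    then show ?thesis using that by (rule base)
  qed
  then have "add_subgroup hull commutators 2 m \<subseteq> ?H"
    by (intro hull_minimal add_subgroup_hull) (auto simp: commutators_2)
  with L_subset_hull[of 2 m] show ?thesis by simp
qed

lemma L_3_subset:
  "L 3 m \<subseteq> add_subgroup hull {\<lbrace>\<lbrace>C i, C j\<rbrace>, C k\<rbrace> |i j k. j < i \<and> k \<le> i \<and> i + j + k = m}"
  (is "_ \<subseteq> ?H")
proof -
  have base: "\<lbrace>\<lbrace>C i, C j\<rbrace>, C k\<rbrace> \<in> ?H" if "j < i" "k \<le> i" "i + j + k = m" for i j k
    using that by (intro hull_inc) blast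
  have gt: "\<lbrace>\<lbrace>C i, C j\<rbrace>, C k\<rbrace> \<in> ?H" if "j < i" "i + j + k = m" for i j k
  proof (cases "k \<le> i")
    case False
    \<comment> \<open>If \<open>k\<close> exceeds \<open>i\<close>, Jacobi moves the largest index
      to the front in both resulting terms.\<close>
    have "\<lbrace>\<lbrace>C i, C j\<rbrace>, C k\<rbrace> = \<lbrace>\<lbrace>C k, C j\<rbrace>, C i\<rbrace> - \<lbrace>\<lbrace>C k, C i\<rbrace>, C j\<rbrace>"
      using lie_jacobi[of "C i" "C j" "C k"] lie_swap[of "C j" "C k"]
      by (simp add: lie_minus_left algebra_simps)
    with that False show ?thesis
      by (simp only:) (intro add_subgroup_diff[OF add_subgroup_hull] base; simp)
  qed (use base that in blast)
  have "\<lbrace>\<lbrace>C i, C j\<rbrace>, C k\<rbrace> \<in> ?H" if "i + j + k = m" for i j k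
  proof (cases i j rule: linorder_cases)
    case less
    then have "- \<lbrace>\<lbrace>C j, C i\<rbrace>, C k\<rbrace> \<in> ?H" using that gt by (intro hull_uminus gt) auto
    then show ?thesis by (simp only: lie_swap[of "C i" "C j"] lie_minus_left)
  next
    case equal
    then show ?thesis by (simp add: lie_self hull_0)
  next
    case greater
    then show ?thesis using that gt by blast
  qed
  then have "add_subgroup hull commutators 3 m \<subseteq> ?H"
    by (intro hull_minimal add_subgroup_hull) (auto simp: commutators_3)
  with L_subset_hull[of 3 m] show ?thesis by simp
qed

section \<open>A representation of the free Lie ring\<close>

text \<open>The universal property maps into types of class \<open>lie_ring\<close>, so the additive
  endomorphisms have to form a type before they can carry a representation.\<close>

typedef (overloaded) 'v endo = "{f :: 'v::ab_group_add \<Rightarrow> 'v. \<forall>x y. f (x + y) = f x + f y}"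
  morphisms app Endo
  by (rule exI[of _ id]) simp

setup_lifting type_definition_endo

lemma app_add: "app f (x + y) = app f x + app f y"
  using app[of f] by simp

lemmas app_diff = additive_diff[of "app f" for f, OF app_add]

instantiation endo :: (ab_group_add) lie_ring
begin

lift_definition zero_endo :: "'a endo" is "\<lambda>x. 0" by simp

lift_definition plus_endo :: "'a endo \<Rightarrow> 'a endo \<Rightarrow> 'a endo" is "\<lambda>f g x. f x + g x"
  by (simp add: algebra_simps)

lift_definition uminus_endo :: "'a endo \<Rightarrow> 'a endo" is "\<lambda>f x. - f x"
  by simp

lift_definition minus_endo :: "'a endo \<Rightarrow> 'a endo \<Rightarrow> 'a endo" is "\<lambda>f g x. f x - g x"
  by (simp add: algebra_simps)

lift_definition lie_endo :: "'a endo \<Rightarrow> 'a endo \<Rightarrow> 'a endo" is "\<lambda>f g x. f (g x) - g (f x)"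
  by (simp add: algebra_simps)

instance
proof
  fix f g h :: "'a endo"
  have eqI: "f = g" if "\<And>x. app f x = app g x" for f g :: "'a endo"
    using that app_inject[of f g] by blast
  show "f + g + h = f + (g + h)" "f + g = g + f" "0 + f = f" "- f + f = 0" "f - g = f + - g"
    by (transfer; simp add: algebra_simps)+
  show "\<lbrace>f + g, h\<rbrace> = \<lbrace>f, h\<rbrace> + \<lbrace>g, h\<rbrace>" "\<lbrace>f, g + h\<rbrace> = \<lbrace>f, g\<rbrace> + \<lbrace>f, h\<rbrace>" "\<lbrace>f, f\<rbrace> = 0"
    by (transfer; simp add: algebra_simps)+
  \<comment> \<open>Nested brackets apply an endomorphism to a difference, which
    \<open>app_diff\<close> expands; the compositions then cancel.\<close>
  show "\<lbrace>\<lbrace>f, g\<rbrace>, h\<rbrace> + \<lbrace>\<lbrace>g, h\<rbrace>, f\<rbrace> + \<lbrace>\<lbrace>h, f\<rbrace>, g\<rbrace> = 0"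
    by (rule eqI) (simp add: plus_endo.rep_eq lie_endo.rep_eq zero_endo.rep_eq app_diff)
qed

end

text \<open>Functions on words are dual to the free associative ring on letters indexed by the
  naturals. This is the transpose of its derivation taking letter \<open>n\<close> to letter
  \<open>Suc n\<close>; \<open>shift_endo n\<close> is the transpose of left multiplication by
  letter \<open>n\<close>.\<close>

primrec increment :: "(nat list \<Rightarrow> int) \<Rightarrow> nat list \<Rightarrow> int" where
  "increment f [] = 0"
| "increment f (n # w) = f (Suc n # w) + increment (\<lambda>u. f (n # u)) w"

lemma increment_add: "increment (\<lambda>w. f w + g w) w = increment f w + increment g w"
  by (induction w arbitrary: f g) simp_all

lift_definition shift_endo :: "nat \<Rightarrow> (nat list \<Rightarrow> int) endo" is "\<lambda>n f w. f (n # w)"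
  by (simp add: fun_eq_iff)

lift_definition increment_endo :: "(nat list \<Rightarrow> int) endo" is increment
  by (simp add: fun_eq_iff plus_fun_def increment_add)

definition rep :: "letter free_lie \<Rightarrow> (nat list \<Rightarrow> int) endo" where
  "rep = free_lie_lift (\<lambda>x. case x of Letter_a \<Rightarrow> shift_endo 0 | Letter_b \<Rightarrow> increment_endo)"

lemma rep_add: "rep (x + y) = rep x + rep y"
  unfolding rep_def by transfer simp

lemma rep_lie: "rep \<lbrace>x, y\<rbrace> = \<lbrace>rep x, rep y\<rbrace>"
  unfolding rep_def by transfer simp

lemma rep_b: "rep \<b> = increment_endo"
  unfolding rep_def by transfer simp

lemma rep_C: "rep (C n) = shift_endo n"
proof (induction n)
  case 0
  show ?case unfolding rep_def C.simps by transfer simp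
next
  case (Suc n)
  \<comment> \<open>In the commutator the second summand of the recursion for
    \<open>increment\<close> cancels, and the first is the next shift.\<close>
  have "\<lbrace>shift_endo n, increment_endo\<rbrace> = shift_endo (Suc n)"
    by transfer (simp add: fun_eq_iff)
  then show ?case using Suc by (simp add: rep_lie rep_b)
qed

lemma app_rep_lie: "app (rep \<lbrace>x, y\<rbrace>) f w = app (rep x) (app (rep y) f) w - app (rep y) (app (rep x) f) w"
  by (simp add: rep_lie lie_endo.rep_eq)

lemma app_rep_add: "app (rep (x + y)) f w = app (rep x) f w + app (rep y) f w"
  by (simp add: rep_add plus_endo.rep_eq)

lemma app_rep_zmult: "app (rep (n *\<^sub>Z x)) f w = n * app (rep x) f w"
  using additive_zmult[of "\<lambda>x. app (rep x) f w" n x] by (simp add: app_rep_add)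

lemma app_rep_C: "app (rep (C n)) f = (\<lambda>w. f (n # w))"
  by (simp add: rep_C shift_endo.rep_eq)

lemma app_rep_b: "app (rep \<b>) f = increment f"
  by (simp add: rep_b increment_endo.rep_eq)

lemmas app_rep_simps =
  app_rep_add app_rep_zmult app_rep_lie app_rep_C app_rep_b

section \<open>The kernel\<close>

lemma L_2_6:
  assumes "A \<in> L 2 6"
  obtains x\<^sub>0 x\<^sub>1 x\<^sub>2 where
    "A = x\<^sub>0 *\<^sub>Z \<lbrace>C 6, C 0\<rbrace> + (x\<^sub>1 *\<^sub>Z \<lbrace>C 5, C 1\<rbrace> + x\<^sub>2 *\<^sub>Z \<lbrace>C 4, C 2\<rbrace>)"
proof -
  let ?S = "{\<lbrace>C 6, C 0\<rbrace>, \<lbrace>C 5, C 1\<rbrace>, \<lbrace>C 4, C 2\<rbrace>}"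
  have "\<lbrace>C i, C j\<rbrace> \<in> ?S" if "j < i" "i + j = 6" for i j
  proof -
    have "(i, j) \<in> {(6, 0), (5, 1), (4, 2)}"
      using that by auto
    then show ?thesis by (auto simp del: C.simps)
  qed
  then have "L 2 6 \<subseteq> add_subgroup hull ?S"
    by (intro order_trans[OF L_2_subset] hull_mono) blast
  with assms have "A \<in> add_subgroup hull ?S" by blast
  then show thesis
    using that by (elim hull_insertE) (simp add: hull_empty del: C.simps)
qed

lemma L_3_5:
  assumes "B \<in> L 3 5"
  obtains y\<^sub>0 y\<^sub>1 y\<^sub>2 y\<^sub>3 y\<^sub>4 y\<^sub>5 y\<^sub>6 where
    "B = y\<^sub>0 *\<^sub>Z \<lbrace>\<lbrace>C 5, C 0\<rbrace>, C 0\<rbrace> + (y\<^sub>1 *\<^sub>Z \<lbrace>\<lbrace>C 4, C 0\<rbrace>, C 1\<rbrace> + (y\<^sub>2 *\<^sub>Z \<lbrace>\<lbrace>C 4, C 1\<rbrace>, C 0\<rbrace>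
      + (y\<^sub>3 *\<^sub>Z \<lbrace>\<lbrace>C 3, C 0\<rbrace>, C 2\<rbrace> + (y\<^sub>4 *\<^sub>Z \<lbrace>\<lbrace>C 3, C 1\<rbrace>, C 1\<rbrace> + (y\<^sub>5 *\<^sub>Z \<lbrace>\<lbrace>C 3, C 2\<rbrace>, C 0\<rbrace>
      + y\<^sub>6 *\<^sub>Z \<lbrace>\<lbrace>C 2, C 1\<rbrace>, C 2\<rbrace>)))))"
proof -
  let ?S = "{\<lbrace>\<lbrace>C 5, C 0\<rbrace>, C 0\<rbrace>, \<lbrace>\<lbrace>C 4, C 0\<rbrace>, C 1\<rbrace>, \<lbrace>\<lbrace>C 4, C 1\<rbrace>, C 0\<rbrace>, \<lbrace>\<lbrace>C 3, C 0\<rbrace>, C 2\<rbrace>,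
    \<lbrace>\<lbrace>C 3, C 1\<rbrace>, C 1\<rbrace>, \<lbrace>\<lbrace>C 3, C 2\<rbrace>, C 0\<rbrace>, \<lbrace>\<lbrace>C 2, C 1\<rbrace>, C 2\<rbrace>}"
  have "\<lbrace>\<lbrace>C i, C j\<rbrace>, C k\<rbrace> \<in> ?S" if "j < i" "k \<le> i" "i + j + k = 5" for i j k
  proof -
    \<comment> \<open>As \<open>i\<close> is the largest of three indices with sum 5, it is at least
      2; \<open>j < i\<close> and \<open>i + j\<close> at most 5 bound \<open>j\<close> by
      2.\<close>
    have "i \<in> {2, 3, 4, 5}" "j \<in> {0, 1, 2}" "k = 5 - i - j"
      using that by auto
    then show ?thesis using that by (elim insertE emptyE) (simp_all del: C.simps)
  qed
  then have "L 3 5 \<subseteq> add_subgroup hull ?S"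
    by (intro order_trans[OF L_3_subset] hull_mono) blast
  with assms have "B \<in> add_subgroup hull ?S" by blast
  then show thesis
    using that by (elim hull_insertE) (simp add: hull_empty del: C.simps)
qed

abbreviation kernel_generator :: "letter free_lie \<times> letter free_lie" where
  "kernel_generator \<equiv>
    ((-2) *\<^sub>Z \<lbrace>C 5, C 1\<rbrace> - 5 *\<^sub>Z \<lbrace>C 4, C 2\<rbrace>,
      2 *\<^sub>Z \<lbrace>\<lbrace>C 4, C 1\<rbrace>, C 0\<rbrace> + 3 *\<^sub>Z \<lbrace>\<lbrace>C 3, C 2\<rbrace>, C 0\<rbrace>
        - 2 *\<^sub>Z \<lbrace>\<lbrace>C 3, C 1\<rbrace>, C 1\<rbrace> + \<lbrace>\<lbrace>C 2, C 1\<rbrace>, C 2\<rbrace>)"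

lemma I_3_6_subset: "I 3 6 \<subseteq> add_subgroup hull {kernel_generator}"
proof
  fix p assume p: "p \<in> I 3 6"
  obtain A B where AB: "p = (A, B)" by (cases p)
  with p have A: "A \<in> L 2 6" and B: "B \<in> L 3 5" and ker: "\<lbrace>A, C 0\<rbrace> + \<lbrace>B, \<b>\<rbrace> = 0"
    by (auto simp: I_def)
  obtain x0 x1 x2 where
    A_eq: "A = x0 *\<^sub>Z \<lbrace>C 6, C 0\<rbrace> + (x1 *\<^sub>Z \<lbrace>C 5, C 1\<rbrace> + x2 *\<^sub>Z \<lbrace>C 4, C 2\<rbrace>)"
    using L_2_6[OF A] .
  obtain y0 y1 y2 y3 y4 y5 t where
    B_eq: "B = y0 *\<^sub>Z \<lbrace>\<lbrace>C 5, C 0\<rbrace>, C 0\<rbrace> + (y1 *\<^sub>Z \<lbrace>\<lbrace>C 4, C 0\<rbrace>, C 1\<rbrace> + (y2 *\<^sub>Z \<lbrace>\<lbrace>C 4, C 1\<rbrace>, C 0\<rbrace>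
      + (y3 *\<^sub>Z \<lbrace>\<lbrace>C 3, C 0\<rbrace>, C 2\<rbrace> + (y4 *\<^sub>Z \<lbrace>\<lbrace>C 3, C 1\<rbrace>, C 1\<rbrace> + (y5 *\<^sub>Z \<lbrace>\<lbrace>C 3, C 2\<rbrace>, C 0\<rbrace>
      + t *\<^sub>Z \<lbrace>\<lbrace>C 2, C 1\<rbrace>, C 2\<rbrace>)))))"
    using L_3_5[OF B] .
  \<comment> \<open>Evaluating the indicator of \<open>v\<close> at the empty word reads off the
    coefficient of the reversed word \<open>v\<close> in the associative expansion in the
    \<open>C n\<close>. The term where \<open>increment\<close> acts last vanishes at the empty
    word.\<close>
  have eq: "app (rep (\<lbrace>A, C 0\<rbrace> + \<lbrace>B, \<b>\<rbrace>)) (\<lambda>w. if w = v then 1 else 0) [] = 0" for v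
    unfolding ker using app_rep_zmult[of 0 0] by simp
  note eqs = eq[unfolded A_eq B_eq, simplified app_rep_simps increment.simps]
  \<comment> \<open>The words match the nine ordered commutators
    \<open>\<lbrace>\<lbrace>C i, C j\<rbrace>, C k\<rbrace>\<close> with
    \<open>i + j + k = 6\<close>: \<open>[i, j, k]\<close> in general, but \<open>[3, 3, 0]\<close>
    for indices 3, 0, 3. Each has coefficient 1 or -1 in its own commutator and 0 in the others.
    \<open>[3, 3, 0]\<close> gives \<open>y3 = 0\<close>, whence \<open>y1\<close>,
    \<open>y0\<close> and \<open>x0\<close> vanish; \<open>[3, 1, 2]\<close> and
    \<open>[3, 2, 1]\<close> give \<open>y4\<close> and \<open>y5\<close>, and the rest follows
    without division. The parameter \<open>t\<close> stays free.\<close>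
  have "x0 = 0 \<and> x1 = - 2 * t \<and> x2 = - 5 * t \<and> y0 = 0 \<and> y1 = 0 \<and> y2 = 2 * t \<and> y3 = 0
    \<and> y4 = - 2 * t \<and> y5 = 3 * t"
    using eqs[of "[6, 0, 0]"] eqs[of "[5, 1, 0]"] eqs[of "[5, 0, 1]"] eqs[of "[4, 2, 0]"]
      eqs[of "[4, 0, 2]"] eqs[of "[4, 1, 1]"] eqs[of "[3, 3, 0]"] eqs[of "[3, 2, 1]"]
      eqs[of "[3, 1, 2]"]
    by simp
  then have "p = t *\<^sub>Z kernel_generator"
    unfolding AB A_eq B_eq
    by (simp add: zmult_Pair zmult_add_right zmult_diff_right zmult_zmult mult.commute
        zmult_minus_left zmult_minus_right del: C.simps)
  then show "p \<in> add_subgroup hull {kernel_generator}"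
    using add_subgroup_zmult[OF add_subgroup_hull hull_inc] by blast
qed

section \<open>The given pair lies in the kernel\<close>

lemma Theta_add: "Theta (p + q) = Theta p + Theta q"
  by (cases p; cases q) (simp add: lie_add_left algebra_simps)

lemma add_subgroup_L: "add_subgroup (L k m)"
  unfolding L_def by (rule add_subgroup_hull)

lemma add_subgroup_I: "add_subgroup (I k m)"
  using add_subgroup_L[of "k - 1" m] add_subgroup_L[of k "m - 1"]
  by (auto simp: add_subgroup_def I_def mem_Times_iff Theta_add additive_0[of Theta, OF Theta_add]
      additive_minus[of Theta, OF Theta_add] simp del: Theta.simps)

lemma kernel_generator_in_I: "kernel_generator \<in> I 3 6"
proof -
  have two: "\<lbrace>C i, C j\<rbrace> \<in> L 2 6" if "i + j = 6" for i j
    using bracket[OF iterated_commutator_C iterated_commutator_C, of i j] that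
    by (auto simp: L_def numeral_2_eq_2 intro: hull_inc)
  have three: "\<lbrace>\<lbrace>C i, C j\<rbrace>, C k\<rbrace> \<in> L 3 5" if "i + j + k = 5" for i j k
    using bracket[OF bracket[OF iterated_commutator_C iterated_commutator_C]
        iterated_commutator_C, of i j k] that
    by (auto simp: L_def numeral_3_eq_3 intro: hull_inc)
  have add: "x + y \<in> L k m" if "x \<in> L k m" "y \<in> L k m" for x y k m
    using add_subgroup_L that by (auto simp: add_subgroup_def)
  note closed = add add_subgroup_diff[OF add_subgroup_L] add_subgroup_zmult[OF add_subgroup_L]
  have "fst kernel_generator \<in> L 2 6" "snd kernel_generator \<in> L 3 5"
    unfolding fst_conv snd_conv by (intro closed two three; simp)+
  moreover have "Theta kernel_generator = 0"
  proof -
    have jacobi: "\<lbrace>\<lbrace>C 3, C 2\<rbrace>, C 1\<rbrace> - \<lbrace>\<lbrace>C 3, C 1\<rbrace>, C 2\<rbrace> + \<lbrace>\<lbrace>C 2, C 1\<rbrace>, C 3\<rbrace> = 0"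
      using lie_jacobi[of "C 3" "C 2" "C 1"] lie_swap[of "C 3" "C 1"]
      by (simp add: lie_minus_left algebra_simps del: C.simps)
    \<comment> \<open>Multiples are written as repeated sums so that simplification in the abelian
      group can cancel them.\<close>
    have scale: "2 *\<^sub>Z x = x + x" "3 *\<^sub>Z x = x + x + x" "5 *\<^sub>Z x = x + x + x + x + x"
      for x :: "letter free_lie"
      using zmult_add_left[of 1 1 x] zmult_add_left[of 2 1 x] zmult_add_left[of 3 2 x]
      by (simp_all add: add.assoc)
    \<comment> \<open>After expansion by \<open>C_derivation3\<close>, terms with two equal inner
      indices vanish by \<open>lie_self\<close>, and those ending in \<open>C 0\<close> or with
      first index 4 or 5 cancel. What is left is the Jacobi sum for \<open>C 3\<close>,
      \<open>C 2\<close>, \<open>C 1\<close>.\<close>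
    have "Theta kernel_generator =
      \<lbrace>\<lbrace>C 3, C 2\<rbrace>, C 1\<rbrace> - \<lbrace>\<lbrace>C 3, C 1\<rbrace>, C 2\<rbrace> + \<lbrace>\<lbrace>C 2, C 1\<rbrace>, C 3\<rbrace>"
      unfolding Theta.simps C.simps(1)[symmetric] zmult_minus_left scale
      by (simp add: lie_add_left lie_minus_left lie_diff_left C_derivation3
          lie_self algebra_simps eval_nat_numeral del: C.simps)
    with jacobi show ?thesis by simp
  qed
  ultimately show ?thesis by (simp add: I_def)
qed

theorem theorem2p8:
  "I 3 6 = add_subgroup hull
    {((-2) *\<^sub>Z \<lbrace>C 5, C 1\<rbrace> - 5 *\<^sub>Z \<lbrace>C 4, C 2\<rbrace>,
      2 *\<^sub>Z \<lbrace>\<lbrace>C 4, C 1\<rbrace>, C 0\<rbrace> + 3 *\<^sub>Z \<lbrace>\<lbrace>C 3, C 2\<rbrace>, C 0\<rbrace>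
        - 2 *\<^sub>Z \<lbrace>\<lbrace>C 3, C 1\<rbrace>, C 1\<rbrace> + \<lbrace>\<lbrace>C 2, C 1\<rbrace>, C 2\<rbrace>)}"
proof (rule equalityI[OF I_3_6_subset])
  show "add_subgroup hull {kernel_generator} \<subseteq> I 3 6"
    using kernel_generator_in_I by (intro hull_minimal add_subgroup_I) simp
qed

end
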